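(* Let $\mathbf{Frm}_{at}$ be the category whose objects are the frames and whose arrows $F\to F'$ are the frame homomorphisms $f:F\to F'$ such that the map $\xi_f:\mathscr{P}(\mathrm{At}(F))\to\mathscr{P}(\mathrm{At}(F'))$, $\xi_f(S)=\bigcup_{p\in S}\psi_{F'}(f(p))$, is complete (i.e. preserves arbitrary infima as well as arbitrary joins). Let $\mathbf{AtFrm}$ be the category of atomic frames and complete frame homomorphisms (those preserving arbitrary infima) between them, and let $i':\mathbf{AtFrm}\hookrightarrow\mathbf{Frm}_{at}$ be the inclusion. Let $L':\mathbf{Frm}_{at}\to\mathbf{AtFrm}$ be the functor sending $F$ to $\mathscr{P}(\mathrm{At}(F))$ and $f:F\to F'$ to $\xi_f$. Then $i'$ identifies $\mathbf{AtFrm}$ with a full reflective subcategory of $\mathbf{Frm}_{at}$, with reflector $L'$.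
   Context: An atom of a frame $F$ is an element $a\neq0$ such that $b\le a$ implies $b=0$ or $b=a$; $\mathrm{At}(F)$ is the set of atoms. A frame is atomic if every element is a join of atoms. $\mathscr{P}(S)$ is the powerset of $S$ ordered by inclusion. For a frame $F$, $\psi_F:F\to\mathscr{P}(\mathrm{At}(F))$ is the map $\psi_F(p)=\{a\in\mathrm{At}(F)\mid a\le p\}$. Arbitrary infima include the empty infimum (top element). *)

theory Defs
  imports "HOL-Algebra.Complete_Lattice" "HOL-Library.FuncSet"
begin

section \<open>Categories, functors, adjunctions\<close>

text \<open>
  Arrows carry no source and target of their own, so composition, and the action of a functor on
  arrows, take the objects as arguments; \<open>cmp C X Y Z g f\<close> is the composite of
  \<open>f : X \<rightarrow> Y\<close> and \<open>g : Y \<rightarrow> Z\<close>.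
\<close>

record ('o, 'm) cat =
  Ob :: "'o set"
  Hom :: "'o \<Rightarrow> 'o \<Rightarrow> 'm set"
  idn :: "'o \<Rightarrow> 'm"
  cmp :: "'o \<Rightarrow> 'o \<Rightarrow> 'o \<Rightarrow> 'm \<Rightarrow> 'm \<Rightarrow> 'm"

locale category =
  fixes C :: "('o, 'm) cat"
  assumes idn_in: "X \<in> Ob C \<Longrightarrow> idn C X \<in> Hom C X X"
    and cmp_in: "\<lbrakk>X \<in> Ob C; Y \<in> Ob C; Z \<in> Ob C; f \<in> Hom C X Y; g \<in> Hom C Y Z\<rbrakk>
      \<Longrightarrow> cmp C X Y Z g f \<in> Hom C X Z"
    and cmp_idn: "\<lbrakk>X \<in> Ob C; Y \<in> Ob C; f \<in> Hom C X Y\<rbrakk> \<Longrightarrow> cmp C X X Y f (idn C X) = f"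
    and idn_cmp: "\<lbrakk>X \<in> Ob C; Y \<in> Ob C; f \<in> Hom C X Y\<rbrakk> \<Longrightarrow> cmp C X Y Y (idn C Y) f = f"
    and cmp_assoc: "\<lbrakk>W \<in> Ob C; X \<in> Ob C; Y \<in> Ob C; Z \<in> Ob C;
        f \<in> Hom C W X; g \<in> Hom C X Y; h \<in> Hom C Y Z\<rbrakk>
      \<Longrightarrow> cmp C W Y Z h (cmp C W X Y g f) = cmp C W X Z (cmp C X Y Z h g) f"

record ('o, 'm, 'p, 'n) fctr =
  on_ob :: "'o \<Rightarrow> 'p"
  on_arr :: "'o \<Rightarrow> 'o \<Rightarrow> 'm \<Rightarrow> 'n"

locale functor_between = source: category C + target: category D
  for C :: "('o, 'm) cat" and D :: "('p, 'n) cat" and T :: "('o, 'm, 'p, 'n) fctr" +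
  assumes ob_in: "X \<in> Ob C \<Longrightarrow> on_ob T X \<in> Ob D"
    and arr_in: "\<lbrakk>X \<in> Ob C; Y \<in> Ob C; f \<in> Hom C X Y\<rbrakk>
      \<Longrightarrow> on_arr T X Y f \<in> Hom D (on_ob T X) (on_ob T Y)"
    and arr_idn: "X \<in> Ob C \<Longrightarrow> on_arr T X X (idn C X) = idn D (on_ob T X)"
    and arr_cmp: "\<lbrakk>X \<in> Ob C; Y \<in> Ob C; Z \<in> Ob C; f \<in> Hom C X Y; g \<in> Hom C Y Z\<rbrakk>
      \<Longrightarrow> on_arr T X Z (cmp C X Y Z g f)
        = cmp D (on_ob T X) (on_ob T Y) (on_ob T Z) (on_arr T Y Z g) (on_arr T X Y f)"

definition fully_faithful ::
    "('o, 'm) cat \<Rightarrow> ('p, 'n) cat \<Rightarrow> ('o, 'm, 'p, 'n) fctr \<Rightarrow> bool" where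
  "fully_faithful C D T \<longleftrightarrow>
    (\<forall>X\<in>Ob C. \<forall>Y\<in>Ob C. bij_betw (on_arr T X Y) (Hom C X Y) (Hom D (on_ob T X) (on_ob T Y)))"

definition full_embedding ::
    "('o, 'm) cat \<Rightarrow> ('p, 'n) cat \<Rightarrow> ('o, 'm, 'p, 'n) fctr \<Rightarrow> bool" where
  "full_embedding C D T \<longleftrightarrow>
    functor_between C D T \<and> inj_on (on_ob T) (Ob C) \<and> fully_faithful C D T"

text \<open>\<open>L : C \<rightarrow> D\<close> is left adjoint to \<open>R : D \<rightarrow> C\<close>: there are bijections
  \<open>D(L X, A) \<cong> C(X, R A)\<close>, natural in \<open>X\<close> and in \<open>A\<close>.\<close>

definition left_adjoint ::
    "('o, 'm) cat \<Rightarrow> ('p, 'n) cat \<Rightarrow> ('o, 'm, 'p, 'n) fctr \<Rightarrow> ('p, 'n, 'o, 'm) fctr \<Rightarrow> bool" where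
  "left_adjoint C D L R \<longleftrightarrow>
    functor_between C D L \<and> functor_between D C R \<and>
    (\<exists>\<Phi> :: 'o \<Rightarrow> 'p \<Rightarrow> 'n \<Rightarrow> 'm.
      (\<forall>X\<in>Ob C. \<forall>A\<in>Ob D. bij_betw (\<Phi> X A) (Hom D (on_ob L X) A) (Hom C X (on_ob R A))) \<and>
      (\<forall>X\<in>Ob C. \<forall>Y\<in>Ob C. \<forall>A\<in>Ob D. \<forall>h\<in>Hom C X Y. \<forall>g\<in>Hom D (on_ob L Y) A.
        \<Phi> X A (cmp D (on_ob L X) (on_ob L Y) A g (on_arr L X Y h))
          = cmp C X Y (on_ob R A) (\<Phi> Y A g) h) \<and>
      (\<forall>X\<in>Ob C. \<forall>A\<in>Ob D. \<forall>B\<in>Ob D. \<forall>k\<in>Hom D A B. \<forall>g\<in>Hom D (on_ob L X) A.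
        \<Phi> X B (cmp D (on_ob L X) A B k g)
          = cmp C X (on_ob R A) (on_ob R B) (on_arr R A B k) (\<Phi> X A g)))"

definition full_reflective ::
    "('p, 'n) cat \<Rightarrow> ('o, 'm) cat \<Rightarrow> ('p, 'n, 'o, 'm) fctr \<Rightarrow> ('o, 'm, 'p, 'n) fctr \<Rightarrow> bool" where
  "full_reflective D C I L \<longleftrightarrow> full_embedding D C I \<and> left_adjoint C D L I"


section \<open>Frames and their atoms\<close>

locale frame = complete_lattice F for F :: "'a gorder" (structure) +
  assumes inf_Sup_distrib:
    "\<lbrakk>x \<in> carrier F; A \<subseteq> carrier F\<rbrakk> \<Longrightarrow> x \<sqinter> (\<Squnion>A) = \<Squnion>((\<lambda>a. x \<sqinter> a) ` A)"

text \<open>Maps are taken to be undefined outside the carrier, so that equality of arrows is equality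
  of functions.\<close>

definition frame_hom :: "'a gorder \<Rightarrow> 'b gorder \<Rightarrow> ('a \<Rightarrow> 'b) set" where
  "frame_hom F F' = {f \<in> carrier F \<rightarrow>\<^sub>E carrier F'.
    sup_pres F F' f \<and> meet_pres F F' f \<and> f \<top>\<^bsub>F\<^esub> = \<top>\<^bsub>F'\<^esub>}"

definition complete_frame_hom :: "'a gorder \<Rightarrow> 'b gorder \<Rightarrow> ('a \<Rightarrow> 'b) set" where
  "complete_frame_hom F F' = {f \<in> frame_hom F F'. inf_pres F F' f}"

definition atoms :: "'a gorder \<Rightarrow> 'a set" where
  "atoms F = {a \<in> carrier F. a \<noteq> \<bottom>\<^bsub>F\<^esub> \<and>
    (\<forall>b\<in>carrier F. b \<sqsubseteq>\<^bsub>F\<^esub> a \<longrightarrow> b = \<bottom>\<^bsub>F\<^esub> \<or> b = a)}"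

definition atomic_frame :: "'a gorder \<Rightarrow> bool" where
  "atomic_frame F \<longleftrightarrow> frame F \<and> (\<forall>p\<in>carrier F. \<exists>S\<subseteq>atoms F. p = \<Squnion>\<^bsub>F\<^esub>S)"

definition powerset_order :: "'a set \<Rightarrow> 'a set gorder" where
  "powerset_order S = \<lparr>carrier = Pow S, eq = (=), le = (\<subseteq>)\<rparr>"

definition psi :: "'a gorder \<Rightarrow> 'a \<Rightarrow> 'a set" where
  "psi F p = {a \<in> atoms F. a \<sqsubseteq>\<^bsub>F\<^esub> p}"

definition xi :: "'b gorder \<Rightarrow> ('a \<Rightarrow> 'b) \<Rightarrow> 'a set \<Rightarrow> 'b set" where
  "xi F' f S = (\<Union>p\<in>S. psi F' (f p))"

definition xi_complete :: "'a gorder \<Rightarrow> 'b gorder \<Rightarrow> ('a \<Rightarrow> 'b) \<Rightarrow> bool" where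
  "xi_complete F F' f \<longleftrightarrow>
    sup_pres (powerset_order (atoms F)) (powerset_order (atoms F')) (xi F' f) \<and>
    inf_pres (powerset_order (atoms F)) (powerset_order (atoms F')) (xi F' f)"


section \<open>The two categories\<close>

text \<open>The type \<open>'u\<close> is the universe in which the carriers of the frames live.\<close>

definition Frm_at :: "('u gorder, 'u \<Rightarrow> 'u) cat" where
  "Frm_at = \<lparr>Ob = {F. frame F},
    Hom = (\<lambda>F F'. {f \<in> frame_hom F F'. xi_complete F F' f}),
    idn = (\<lambda>F. restrict id (carrier F)),
    cmp = (\<lambda>F F' F'' g f. compose (carrier F) g f)\<rparr>"

definition AtFrm :: "('u gorder, 'u \<Rightarrow> 'u) cat" where
  "AtFrm = \<lparr>Ob = {F. atomic_frame F},
    Hom = complete_frame_hom,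
    idn = (\<lambda>F. restrict id (carrier F)),
    cmp = (\<lambda>F F' F'' g f. compose (carrier F) g f)\<rparr>"

definition incl :: "('u gorder, 'u \<Rightarrow> 'u, 'u gorder, 'u \<Rightarrow> 'u) fctr" where
  "incl = \<lparr>on_ob = (\<lambda>F. F), on_arr = (\<lambda>F F' f. f)\<rparr>"


section \<open>The reflector\<close>

text \<open>
  For a frame \<open>F\<close> on \<open>'u\<close> the elements of \<open>powerset_order (atoms F)\<close> are of type
  \<open>'u set\<close> rather than \<open>'u\<close>. To have that powerset as an object of the same category, its
  elements, the sets of atoms of \<open>F\<close>, are named by elements of \<open>'u\<close> through an injection
  \<open>enc F\<close>, and the order and the maps \<open>xi\<close> are transported along these injections.
  Nothing else is required of \<open>enc\<close>: if \<open>'u\<close> contains a copy of \<open>'a set\<close>, say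
  \<open>'u = 'a + 'a set\<close>, then for the frames carried by the summand \<open>'a\<close> one may take the powerset
  itself. An encoding exists for every \<open>'u\<close>, see \<open>set_encoding_Sup\<close> below.
\<close>

definition transport_order :: "('a \<Rightarrow> 'b) \<Rightarrow> 'a gorder \<Rightarrow> 'b gorder" where
  "transport_order e P = \<lparr>carrier = e ` carrier P, eq = (=),
    le = (\<lambda>x y. inv_into (carrier P) e x \<sqsubseteq>\<^bsub>P\<^esub> inv_into (carrier P) e y)\<rparr>"

definition transport_map ::
    "('a \<Rightarrow> 'b) \<Rightarrow> 'a gorder \<Rightarrow> ('c \<Rightarrow> 'd) \<Rightarrow> ('a \<Rightarrow> 'c) \<Rightarrow> 'b \<Rightarrow> 'd" where
  "transport_map e P e' f = (\<lambda>x \<in> e ` carrier P. e' (f (inv_into (carrier P) e x)))"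

definition set_encoding :: "('u gorder \<Rightarrow> 'u set \<Rightarrow> 'u) \<Rightarrow> bool" where
  "set_encoding enc \<longleftrightarrow> (\<forall>F. frame F \<longrightarrow> inj_on (enc F) (Pow (atoms F)))"

definition reflector ::
    "('u gorder \<Rightarrow> 'u set \<Rightarrow> 'u) \<Rightarrow> ('u gorder, 'u \<Rightarrow> 'u, 'u gorder, 'u \<Rightarrow> 'u) fctr" where
  "reflector enc = \<lparr>
    on_ob = (\<lambda>F. transport_order (enc F) (powerset_order (atoms F))),
    on_arr = (\<lambda>F F' f. transport_map (enc F) (powerset_order (atoms F)) (enc F') (xi F' f))\<rparr>"

lemma (in frame) atom_le_Sup:
  assumes a: "a \<in> atoms F" and S: "S \<subseteq> atoms F" and le: "a \<sqsubseteq> \<Squnion>S"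
  shows "a \<in> S"
proof (rule ccontr)
  assume "a \<notin> S"
  have ac: "a \<in> carrier F" and Sc: "S \<subseteq> carrier F"
    using a S by (auto simp: atoms_def)
  have "a \<sqinter> s = \<bottom>" if s: "s \<in> S" for s
  proof -
    have sc: "s \<in> carrier F" using s Sc by auto
    have m: "a \<sqinter> s \<in> carrier F" "a \<sqinter> s \<sqsubseteq> a" "a \<sqinter> s \<sqsubseteq> s"
      using ac sc by (auto intro: meet_left meet_right)
    have "a \<sqinter> s = \<bottom> \<or> a \<sqinter> s = a" "a \<sqinter> s = \<bottom> \<or> a \<sqinter> s = s"
      using m a s S unfolding atoms_def by blast+
    then show ?thesis using \<open>a \<notin> S\<close> s by metis
  qed
  then have img: "(\<lambda>s. a \<sqinter> s) ` S \<subseteq> {\<bottom>}" by auto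
  have "a \<sqinter> (\<Squnion>S) = \<Squnion>((\<lambda>s. a \<sqinter> s) ` S)"
    using inf_Sup_distrib[OF ac Sc] .
  also have "\<dots> \<sqsubseteq> \<bottom>"
    by (rule sup_least) (use img in auto)
  finally have b: "a \<sqinter> (\<Squnion>S) \<sqsubseteq> \<bottom>" .
  have "a \<sqsubseteq> a \<sqinter> (\<Squnion>S)"
    using ac Sc le by (intro meet_le) auto
  then have "a \<sqsubseteq> \<bottom>"
    using b ac Sc by (meson le_trans meet_closed sup_closed bottom_closed)
  then have "a = \<bottom>"
    using ac by (meson le_antisym bottom_closed bottom_lower)
  then show False using a by (simp add: atoms_def)
qed

lemma (in frame) inj_on_Sup_atoms: "inj_on (Lattice.sup F) (Pow (atoms F))"
proof -
  have *: "S \<subseteq> T" if "S \<subseteq> atoms F" "T \<subseteq> atoms F" "\<Squnion>S = \<Squnion>T" for S T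
  proof
    fix a assume "a \<in> S"
    moreover have "S \<subseteq> carrier F" using that by (auto simp: atoms_def)
    ultimately have "a \<sqsubseteq> \<Squnion>S" by (intro sup_upper)
    then show "a \<in> T" using atom_le_Sup[of a T] that \<open>a \<in> S\<close> by auto
  qed
  show ?thesis
    by (rule inj_onI) (use * in \<open>metis PowD subset_antisym\<close>)
qed

lemma set_encoding_Sup: "set_encoding Lattice.sup"
  by (simp add: set_encoding_def frame.inj_on_Sup_atoms)

end

theory Submission
  imports Defs
begin

text \<open>
  Everything rests on one observation about a frame homomorphism \<open>f : F \<rightarrow> F'\<close>. If an atom
  \<open>b\<close> of \<open>F'\<close> lies below \<open>f a\<close> for some atom \<open>a\<close>, and also below \<open>f x\<close>, then \<open>b\<close> lies below
  \<open>f (a \<sqinter> x)\<close>, so \<open>a \<sqinter> x\<close> is not \<open>\<bottom>\<close> and \<open>a \<sqsubseteq> x\<close> (\<open>atom_le_image\<close>). Hence the atom \<open>a\<close> with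
  \<open>b \<sqsubseteq> f a\<close> is unique if it exists, and \<open>xi F' f\<close> is the inverse image along a partial function from
  the atoms of \<open>F'\<close> to those of \<open>F\<close>. Such an inverse image map preserves all unions and all nonempty
  intersections; it preserves the empty intersection exactly when the partial function is total. So
  the condition that defines the arrows of \<open>Frm_at\<close> says that every atom of \<open>F'\<close> lies below the image
  of an atom (\<open>xi_complete_iff\<close>); such an \<open>f\<close> is called atom covering here.

  For an atom covering \<open>f\<close> the observation also gives \<open>psi F' (f x) = xi F' f (psi F x)\<close> for all \<open>x\<close>
  (\<open>psi_image\<close>), and everything else follows.

  \<^item> Fullness. If \<open>F\<close> is atomic, its top is a join of atoms, so every frame homomorphism out of \<open>F\<close>
    is atom covering. If \<open>F'\<close> is atomic, equations in \<open>F'\<close> may be tested by \<open>psi F'\<close>, and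
    \<open>psi_image\<close> shows that an atom covering \<open>f\<close> preserves all infima. Between atomic frames the two
    categories therefore have the same arrows.

  \<^item> Reflection. The map \<open>psi F\<close> into the powerset of the atoms is atom covering, and it is the unit.
    An atom covering \<open>f : F \<rightarrow> A\<close> into an atomic frame extends along it by sending a set \<open>X\<close> of
    atoms to the join of \<open>f ` X\<close>: under \<open>psi A\<close> this is \<open>xi A f X\<close>, which shows that the extension
    is a homomorphism and restricts to \<open>f\<close>. The extension is unique because the singletons, which
    are the values of the unit at the atoms, generate the powerset under joins.

  \<^item> The action of the reflector on \<open>f : F \<rightarrow> F'\<close> is the extension of the unit of \<open>F'\<close> after \<open>f\<close>
    (\<open>transport_xi_eq_extension\<close>). Functoriality and the adjunction are then formal consequences of
    the universal property of the units.
\<close>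


section \<open>Adjunctions from universal arrows\<close>

text \<open>
  The functor laws for \<open>L\<close> are conclusions here: both sides of each law become equal after
  composition with the unit, and the universal property makes that composition injective.
\<close>

lemma left_adjoint_if_universal_arrows:
  fixes C :: "('o, 'm) cat" and D :: "('p, 'n) cat"
    and L :: "('o, 'm, 'p, 'n) fctr" and R :: "('p, 'n, 'o, 'm) fctr"
  assumes R: "functor_between D C R"
    and ob: "\<And>X. X \<in> Ob C \<Longrightarrow> on_ob L X \<in> Ob D"
    and arr: "\<And>X Y f. \<lbrakk>X \<in> Ob C; Y \<in> Ob C; f \<in> Hom C X Y\<rbrakk>
      \<Longrightarrow> on_arr L X Y f \<in> Hom D (on_ob L X) (on_ob L Y)"
    and unit: "\<And>X. X \<in> Ob C \<Longrightarrow> \<eta> X \<in> Hom C X (on_ob R (on_ob L X))"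
    and natural: "\<And>X Y f. \<lbrakk>X \<in> Ob C; Y \<in> Ob C; f \<in> Hom C X Y\<rbrakk>
      \<Longrightarrow> cmp C X (on_ob R (on_ob L X)) (on_ob R (on_ob L Y))
            (on_arr R (on_ob L X) (on_ob L Y) (on_arr L X Y f)) (\<eta> X)
        = cmp C X Y (on_ob R (on_ob L Y)) (\<eta> Y) f"
    and universal: "\<And>X A. \<lbrakk>X \<in> Ob C; A \<in> Ob D\<rbrakk>
      \<Longrightarrow> bij_betw
            (\<lambda>g. cmp C X (on_ob R (on_ob L X)) (on_ob R A) (on_arr R (on_ob L X) A g) (\<eta> X))
            (Hom D (on_ob L X) A) (Hom C X (on_ob R A))"
  shows "left_adjoint C D L R"
proof -
  interpret R: functor_between D C R by (rule R)
  define \<Phi> where "\<Phi> X A g =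
    cmp C X (on_ob R (on_ob L X)) (on_ob R A) (on_arr R (on_ob L X) A g) (\<eta> X)" for X A g
  have \<Phi>_arr: "\<Phi> X (on_ob L Y) (on_arr L X Y f) = cmp C X Y (on_ob R (on_ob L Y)) (\<eta> Y) f"
    if "X \<in> Ob C" "Y \<in> Ob C" "f \<in> Hom C X Y" for X Y f
    unfolding \<Phi>_def using that by (rule natural)
  have \<Phi>_cmp: "\<Phi> X B (cmp D (on_ob L X) A B k g)
      = cmp C X (on_ob R A) (on_ob R B) (on_arr R A B k) (\<Phi> X A g)"
    if "X \<in> Ob C" "A \<in> Ob D" "B \<in> Ob D" "g \<in> Hom D (on_ob L X) A" "k \<in> Hom D A B" for X A B g k
    using that by (simp add: \<Phi>_def R.arr_cmp R.target.cmp_assoc R.arr_in R.ob_in ob unit)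
  have \<Phi>_nat: "\<Phi> X A (cmp D (on_ob L X) (on_ob L Y) A g (on_arr L X Y h))
      = cmp C X Y (on_ob R A) (\<Phi> Y A g) h"
    if "X \<in> Ob C" "Y \<in> Ob C" "A \<in> Ob D" "h \<in> Hom C X Y" "g \<in> Hom D (on_ob L Y) A" for X Y A g h
  proof -
    have "\<Phi> X A (cmp D (on_ob L X) (on_ob L Y) A g (on_arr L X Y h))
        = cmp C X (on_ob R (on_ob L Y)) (on_ob R A) (on_arr R (on_ob L Y) A g)
            (cmp C X Y (on_ob R (on_ob L Y)) (\<eta> Y) h)"
      using that by (simp add: \<Phi>_cmp \<Phi>_arr ob arr)
    also have "\<dots> = cmp C X Y (on_ob R A) (\<Phi> Y A g) h"
      using that by (simp add: \<Phi>_def R.target.cmp_assoc R.arr_in R.ob_in ob unit)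
    finally show ?thesis .
  qed
  have \<Phi>_inj: "g = g'"
    if "X \<in> Ob C" "A \<in> Ob D" "g \<in> Hom D (on_ob L X) A" "g' \<in> Hom D (on_ob L X) A"
      "\<Phi> X A g = \<Phi> X A g'" for X A g g'
    using universal[OF that(1,2)] that(3-5) unfolding \<Phi>_def bij_betw_def inj_on_def by blast
  have L: "functor_between C D L"
  proof unfold_locales
    fix X assume X: "X \<in> Ob C"
    show "on_arr L X X (idn C X) = idn D (on_ob L X)"
    proof (rule \<Phi>_inj[OF X ob[OF X]])
      show "\<Phi> X (on_ob L X) (on_arr L X X (idn C X)) = \<Phi> X (on_ob L X) (idn D (on_ob L X))"
        using X by (simp add: \<Phi>_arr R.target.idn_in)
          (simp add: \<Phi>_def R.arr_idn R.target.idn_cmp R.target.cmp_idn R.ob_in ob unit)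
    qed (use X in \<open>auto intro: arr ob R.source.idn_in R.target.idn_in\<close>)
  next
    fix X Y Z f g
    assume *: "X \<in> Ob C" "Y \<in> Ob C" "Z \<in> Ob C" "f \<in> Hom C X Y" "g \<in> Hom C Y Z"
    show "on_arr L X Z (cmp C X Y Z g f)
      = cmp D (on_ob L X) (on_ob L Y) (on_ob L Z) (on_arr L Y Z g) (on_arr L X Y f)"
    proof (rule \<Phi>_inj[OF *(1) ob[OF *(3)]])
      show "\<Phi> X (on_ob L Z) (on_arr L X Z (cmp C X Y Z g f)) = \<Phi> X (on_ob L Z)
          (cmp D (on_ob L X) (on_ob L Y) (on_ob L Z) (on_arr L Y Z g) (on_arr L X Y f))"
        using * by (simp add: \<Phi>_nat \<Phi>_arr R.target.cmp_in R.target.cmp_assoc R.ob_in ob unit arr)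
    qed (use * in \<open>auto intro!: arr ob R.source.cmp_in[of _ "on_ob L Y"] R.target.cmp_in[of _ Y]\<close>)
  qed (use ob arr in auto)
  show ?thesis
    unfolding left_adjoint_def
  proof (intro conjI L R exI[of _ \<Phi>] ballI)
    show "bij_betw (\<Phi> X A) (Hom D (on_ob L X) A) (Hom C X (on_ob R A))"
      if "X \<in> Ob C" "A \<in> Ob D" for X A
      using universal[OF that] unfolding \<Phi>_def .
  qed (simp_all add: \<Phi>_nat \<Phi>_cmp)
qed


section \<open>Atoms as points of a frame\<close>

lemma atoms_carrier: "a \<in> atoms F \<Longrightarrow> a \<in> carrier F"
  by (simp add: atoms_def)

lemma atoms_subset_carrier: "atoms F \<subseteq> carrier F"
  by (auto simp: atoms_def)

lemma psi_subset_atoms: "psi F x \<subseteq> atoms F"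
  by (auto simp: psi_def)

context frame
begin

lemma atom_not_le_bottom: "a \<in> atoms F \<Longrightarrow> \<not> a \<sqsubseteq> \<bottom>"
  using le_antisym[of a \<bottom>] by (auto simp: atoms_def)

lemma atom_meet_cases:
  assumes "a \<in> atoms F" "x \<in> carrier F"
  shows "a \<sqinter> x = \<bottom> \<or> a \<sqsubseteq> x"
proof -
  have "a \<in> carrier F" using assms by (simp add: atoms_def)
  then have "a \<sqinter> x = \<bottom> \<or> a \<sqinter> x = a"
    using assms meet_left[of a x] by (auto simp: atoms_def)
  then show ?thesis
    using meet_right[of a x] \<open>a \<in> carrier F\<close> assms(2) by auto
qed

lemma atom_le_atom: "\<lbrakk>a \<in> atoms F; b \<in> atoms F; a \<sqsubseteq> b\<rbrakk> \<Longrightarrow> a = b"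
  by (auto simp: atoms_def)

text \<open>Atoms are completely join prime, because \<open>a \<sqinter> \<Squnion>A\<close> is the join of elements \<open>a \<sqinter> x\<close>, each of
  which is \<open>\<bottom>\<close> unless \<open>a \<sqsubseteq> x\<close>.\<close>

lemma atom_le_Sup_iff:
  assumes a: "a \<in> atoms F" and A: "A \<subseteq> carrier F"
  shows "a \<sqsubseteq> \<Squnion>A \<longleftrightarrow> (\<exists>x\<in>A. a \<sqsubseteq> x)"
proof
  have ac: "a \<in> carrier F" using a by (rule atoms_carrier)
  assume le: "a \<sqsubseteq> \<Squnion>A"
  show "\<exists>x\<in>A. a \<sqsubseteq> x"
  proof (rule ccontr)
    assume "\<not> ?thesis"
    then have "\<forall>x\<in>A. a \<sqinter> x = \<bottom>" using atom_meet_cases[OF a] A by blast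
    then have "\<Squnion>((\<lambda>x. a \<sqinter> x) ` A) \<sqsubseteq> \<bottom>" by (intro sup_least) auto
    moreover have "a \<sqsubseteq> a \<sqinter> \<Squnion>A" using ac A le by (intro meet_le) auto
    ultimately have "a \<sqsubseteq> \<bottom>"
      using inf_Sup_distrib[OF ac A] ac A le_trans[of a "a \<sqinter> \<Squnion>A" \<bottom>]
      by (metis bottom_closed meet_closed sup_closed)
    then show False using atom_not_le_bottom[OF a] by blast
  qed
next
  assume "\<exists>x\<in>A. a \<sqsubseteq> x"
  then obtain x where x: "x \<in> A" "a \<sqsubseteq> x" by blast
  show "a \<sqsubseteq> \<Squnion>A"
    using le_trans[OF x(2) sup_upper[OF A x(1)]] x A a by (auto simp: atoms_carrier)
qed

lemma psi_Sup: "A \<subseteq> carrier F \<Longrightarrow> psi F (\<Squnion>A) = (\<Union>x\<in>A. psi F x)"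
  by (auto simp: psi_def atom_le_Sup_iff)

lemma psi_Inf:
  assumes A: "A \<subseteq> carrier F"
  shows "psi F (\<Sqinter>A) = atoms F \<inter> (\<Inter>x\<in>A. psi F x)"
proof -
  have "a \<sqsubseteq> \<Sqinter>A \<longleftrightarrow> (\<forall>x\<in>A. a \<sqsubseteq> x)" if "a \<in> carrier F" for a
  proof
    assume le: "a \<sqsubseteq> \<Sqinter>A"
    show "\<forall>x\<in>A. a \<sqsubseteq> x"
    proof
      fix x assume "x \<in> A"
      then show "a \<sqsubseteq> x" using le_trans[OF le inf_lower[OF A]] that A by auto
    qed
  qed (use that A in \<open>auto intro: inf_greatest\<close>)
  then show ?thesis by (auto simp: psi_def atoms_carrier)
qed

lemma psi_meet: "\<lbrakk>x \<in> carrier F; y \<in> carrier F\<rbrakk> \<Longrightarrow> psi F (x \<sqinter> y) = psi F x \<inter> psi F y"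
  using psi_Inf[of "{x, y}"] by (auto simp: meet_def psi_def)

lemma psi_top: "psi F \<top> = atoms F"
  by (auto simp: psi_def atoms_carrier)

lemma psi_atom: "a \<in> atoms F \<Longrightarrow> psi F a = {a}"
  by (auto simp: psi_def atoms_carrier atom_le_atom)

end

lemma atomic_frame_frame: "atomic_frame F \<Longrightarrow> frame F"
  by (simp add: atomic_frame_def)

lemma Sup_psi:
  assumes "atomic_frame F" "x \<in> carrier F"
  shows "\<Squnion>\<^bsub>F\<^esub>(psi F x) = x"
proof -
  interpret frame F using assms by (simp add: atomic_frame_def)
  obtain S where S: "S \<subseteq> atoms F" "x = \<Squnion>\<^bsub>F\<^esub>S" using assms by (auto simp: atomic_frame_def)
  then have "S \<subseteq> carrier F" by (auto simp: atoms_def)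
  moreover have "(\<Union>a\<in>S. psi F a) = (\<Union>a\<in>S. {a})"
    using S psi_atom by (intro SUP_cong) auto
  ultimately have "psi F x = S" using S by (simp add: psi_Sup)
  then show ?thesis using S by simp
qed

text \<open>An atomic frame is spatial: its elements are separated by the atoms below them. Equations in such
  a frame are proved below by comparing the two sides under \<open>psi\<close>.\<close>

lemma psi_inject:
  assumes "atomic_frame F" "x \<in> carrier F" "y \<in> carrier F" "psi F x = psi F y"
  shows "x = y"
  using assms Sup_psi by metis


section \<open>Powersets, and copies of powersets, as frames\<close>

text \<open>
  The copy \<open>P\<close> is described by its order on the image of \<open>e\<close> only, since \<open>powerset_order S\<close> (with
  \<open>e\<close> the identity) and its transports are both instances although they differ off the carrier.
\<close>

locale powerset_copy =
  fixes S :: "'a set" and P :: "'b gorder" (structure) and e :: "'a set \<Rightarrow> 'b"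
  assumes bij: "bij_betw e (Pow S) (carrier P)"
    and eq: "eq P = (=)"
    and le_iff: "\<lbrakk>X \<subseteq> S; Y \<subseteq> S\<rbrakk> \<Longrightarrow> e X \<sqsubseteq> e Y \<longleftrightarrow> X \<subseteq> Y"
begin

lemma carrierE:
  assumes "x \<in> carrier P" obtains X where "X \<subseteq> S" "x = e X"
  using assms bij by (auto simp: bij_betw_def)

lemma e_closed: "X \<subseteq> S \<Longrightarrow> e X \<in> carrier P"
  using bij by (auto simp: bij_betw_def)

lemma e_eq_iff: "\<lbrakk>X \<subseteq> S; Y \<subseteq> S\<rbrakk> \<Longrightarrow> e X = e Y \<longleftrightarrow> X = Y"
  using bij by (auto simp: bij_betw_def inj_on_def)

lemma subset_carrierE:
  assumes "A \<subseteq> carrier P" obtains Q where "Q \<subseteq> Pow S" "A = e ` Q"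
  using assms bij by (metis bij_betw_def subset_image_iff)

lemma Union_least:
  assumes Q: "Q \<subseteq> Pow S"
  shows "least P (e (\<Union>Q)) (Upper P (e ` Q))"
proof (rule least_UpperI)
  have QS: "X \<subseteq> S" if "X \<in> Q" for X using that Q by auto
  have US: "\<Union>Q \<subseteq> S" using Q by auto
  show "e ` Q \<subseteq> carrier P" "e (\<Union>Q) \<in> carrier P" using QS US e_closed by auto
  show "x \<sqsubseteq> e (\<Union>Q)" if "x \<in> e ` Q" for x
    using that QS US by (auto simp: le_iff)
  show "e (\<Union>Q) \<sqsubseteq> y" if y: "y \<in> Upper P (e ` Q)" for y
  proof -
    have "y \<in> carrier P" using y by (simp add: Upper_def)
    then obtain Y where Y: "Y \<subseteq> S" "y = e Y" by (rule carrierE)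
    have "X \<subseteq> Y" if "X \<in> Q" for X
      using y that Y QS[OF that] by (auto simp: Upper_def e_closed simp flip: le_iff)
    then show ?thesis using Y US by (auto simp: le_iff)
  qed
qed

lemma Inter_greatest:
  assumes Q: "Q \<subseteq> Pow S"
  shows "greatest P (e (S \<inter> \<Inter>Q)) (Lower P (e ` Q))"
proof (rule greatest_LowerI)
  have QS: "X \<subseteq> S" if "X \<in> Q" for X using that Q by auto
  show "e ` Q \<subseteq> carrier P" "e (S \<inter> \<Inter>Q) \<in> carrier P" using QS e_closed by auto
  show "e (S \<inter> \<Inter>Q) \<sqsubseteq> x" if x: "x \<in> e ` Q" for x
  proof -
    obtain X where "X \<in> Q" "x = e X" using x by auto
    then show ?thesis using QS le_iff[of "S \<inter> \<Inter>Q" X] by auto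
  qed
  show "y \<sqsubseteq> e (S \<inter> \<Inter>Q)" if y: "y \<in> Lower P (e ` Q)" for y
  proof -
    have "y \<in> carrier P" using y by (simp add: Lower_def)
    then obtain Y where Y: "Y \<subseteq> S" "y = e Y" by (rule carrierE)
    have "Y \<subseteq> X" if "X \<in> Q" for X
      using y that Y QS[OF that] by (auto simp: Lower_def e_closed simp flip: le_iff)
    then show ?thesis using Y le_iff[of Y "S \<inter> \<Inter>Q"] by auto
  qed
qed

sublocale complete_lattice P
proof
  show "\<exists>s. least P s (Upper P A)" if "A \<subseteq> carrier P" for A
    using that by (auto elim!: subset_carrierE intro: Union_least)
  show "\<exists>s. greatest P s (Lower P A)" if "A \<subseteq> carrier P" for A
    using that by (auto elim!: subset_carrierE intro: Inter_greatest)
qed (auto simp: eq le_iff elim!: carrierE)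

lemma Sup_image: "Q \<subseteq> Pow S \<Longrightarrow> \<Squnion>(e ` Q) = e (\<Union>Q)"
  using e_closed by (intro least_unique[OF sup_lub Union_least]) auto

lemma Inf_image: "Q \<subseteq> Pow S \<Longrightarrow> \<Sqinter>(e ` Q) = e (S \<inter> \<Inter>Q)"
  using e_closed by (intro greatest_unique[OF inf_glb Inter_greatest]) auto

lemma meet_image: "\<lbrakk>X \<subseteq> S; Y \<subseteq> S\<rbrakk> \<Longrightarrow> e X \<sqinter> e Y = e (X \<inter> Y)"
  using Inf_image[of "{X, Y}"] by (simp add: meet_def Int_absorb1 le_infI1)

lemma top_image: "\<top> = e S"
  using Inf_image[of "{}"] weak_inf_empty by (simp add: eq_is_equal)

lemma bottom_image: "\<bottom> = e {}"
  using Sup_image[of "{}"] weak_sup_empty by (simp add: eq_is_equal)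

sublocale frame P
proof
  fix x A assume "x \<in> carrier P" "A \<subseteq> carrier P"
  then obtain X Q where *: "X \<subseteq> S" "x = e X" "Q \<subseteq> Pow S" "A = e ` Q"
    by (metis carrierE subset_carrierE)
  have UQ: "\<Union>Q \<subseteq> S" using * by auto
  have "(\<lambda>a. x \<sqinter> a) ` A = e ` ((\<lambda>Y. X \<inter> Y) ` Q)"
    using * by (auto simp: image_image meet_image intro!: image_cong)
  moreover have "(\<lambda>Y. X \<inter> Y) ` Q \<subseteq> Pow S" using * by auto
  ultimately have "\<Squnion>((\<lambda>a. x \<sqinter> a) ` A) = e (\<Union>Y\<in>Q. X \<inter> Y)"
    using Sup_image[of "(\<lambda>Y. X \<inter> Y) ` Q"] by simp
  also have "(\<Union>Y\<in>Q. X \<inter> Y) = X \<inter> \<Union>Q" by auto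
  also have "e (X \<inter> \<Union>Q) = x \<sqinter> \<Squnion>A"
    using * Sup_image[of Q] meet_image[of X "\<Union>Q"] UQ by simp
  finally show "x \<sqinter> \<Squnion>A = \<Squnion>((\<lambda>a. x \<sqinter> a) ` A)" by simp
qed

lemma atoms_image: "atoms P = (\<lambda>a. e {a}) ` S"
proof (intro equalityI subsetI)
  fix x assume x: "x \<in> atoms P"
  then obtain X where X: "X \<subseteq> S" "x = e X" by (auto simp: atoms_def elim: carrierE)
  with x have "X \<noteq> {}" by (auto simp: atoms_def bottom_image)
  then obtain a where a: "a \<in> X" by blast
  with X have aS: "{a} \<subseteq> S" by auto
  with X a have "e {a} \<sqsubseteq> x" "e {a} \<in> carrier P" using le_iff[of "{a}" X] e_closed by auto
  with x have "e {a} = e {} \<or> e {a} = x" by (auto simp: atoms_def bottom_image)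
  then have "x = e {a}" using aS e_eq_iff[of "{a}" "{}"] by auto
  then show "x \<in> (\<lambda>a. e {a}) ` S" using aS by blast
qed (auto simp: atoms_def bottom_image e_eq_iff le_iff e_closed subset_singleton_iff elim!: carrierE)

lemma atomic: "atomic_frame P"
  unfolding atomic_frame_def
proof (intro conjI ballI)
  fix x assume "x \<in> carrier P"
  then obtain X where X: "X \<subseteq> S" "x = e X" by (rule carrierE)
  have "(\<lambda>a. {a}) ` X \<subseteq> Pow S" using X by auto
  then have "x = \<Squnion>((\<lambda>a. e {a}) ` X)" using X Sup_image[of "(\<lambda>a. {a}) ` X"] by (simp add: image_image)
  moreover have "(\<lambda>a. e {a}) ` X \<subseteq> atoms P" using X by (auto simp: atoms_image)
  ultimately show "\<exists>T\<subseteq>atoms P. x = \<Squnion>T" by blast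
qed (rule frame_axioms)

end

lemma powerset_copy_powerset_order: "powerset_copy S (powerset_order S) (\<lambda>X. X)"
  by standard (auto simp: powerset_order_def bij_betw_def)

lemma powerset_copy_transport_order:
  assumes "inj_on e (Pow S)"
  shows "powerset_copy S (transport_order e (powerset_order S)) e"
  by standard (use assms in \<open>auto simp: powerset_order_def transport_order_def bij_betw_def\<close>)


section \<open>The arrows of the two categories\<close>

text \<open>For a frame homomorphism \<open>f\<close> this says that \<open>f\<close> has a map on atoms, backwards: the partial function that takes an atom \<open>b\<close> of \<open>F'\<close> to the atom
  \<open>a\<close> of \<open>F\<close> with \<open>b \<sqsubseteq> f a\<close> is total.\<close>

definition atom_covering :: "'a gorder \<Rightarrow> 'b gorder \<Rightarrow> ('a \<Rightarrow> 'b) \<Rightarrow> bool" where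
  "atom_covering F F' f \<longleftrightarrow> (\<forall>b\<in>atoms F'. \<exists>a\<in>atoms F. b \<sqsubseteq>\<^bsub>F'\<^esub> f a)"

locale frame_morphism = source: frame F + target: frame F'
  for F :: "'a gorder" and F' :: "'b gorder" and f :: "'a \<Rightarrow> 'b" +
  assumes hom: "f \<in> frame_hom F F'"
begin

lemma closed: "x \<in> carrier F \<Longrightarrow> f x \<in> carrier F'"
  using hom by (auto simp: frame_hom_def)

lemma Sup: "A \<subseteq> carrier F \<Longrightarrow> f (\<Squnion>\<^bsub>F\<^esub>A) = \<Squnion>\<^bsub>F'\<^esub>(f ` A)"
  using hom by (auto simp: frame_hom_def sup_pres_def)

lemma meet: "\<lbrakk>x \<in> carrier F; y \<in> carrier F\<rbrakk> \<Longrightarrow> f (x \<sqinter>\<^bsub>F\<^esub> y) = f x \<sqinter>\<^bsub>F'\<^esub> f y"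
  using hom by (auto simp: frame_hom_def meet_pres_def)

lemma top: "f \<top>\<^bsub>F\<^esub> = \<top>\<^bsub>F'\<^esub>"
  using hom by (auto simp: frame_hom_def)

lemma bottom: "f \<bottom>\<^bsub>F\<^esub> = \<bottom>\<^bsub>F'\<^esub>"
  using Sup[of "{}"] source.weak_sup_empty target.weak_sup_empty
  by (simp add: source.eq_is_equal target.eq_is_equal)

lemma mono:
  assumes "x \<in> carrier F" "y \<in> carrier F" "x \<sqsubseteq>\<^bsub>F\<^esub> y"
  shows "f x \<sqsubseteq>\<^bsub>F'\<^esub> f y"
proof -
  have "x = x \<sqinter>\<^bsub>F\<^esub> y" using assms by (simp add: source.le_iff_join)
  then show ?thesis using assms meet[of x y] closed by (metis target.meet_right)
qed

text \<open>An atom \<open>b\<close> below both \<open>f a\<close> and \<open>f x\<close> is below \<open>f (a \<sqinter> x)\<close>, and \<open>f\<close> would send \<open>a \<sqinter> x\<close> to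
  \<open>\<bottom>\<close> if \<open>a\<close> were not below \<open>x\<close>. With \<open>x\<close> an atom this is the uniqueness of \<open>a\<close> for given \<open>b\<close>.\<close>

lemma atom_le_image:
  assumes b: "b \<in> atoms F'" and a: "a \<in> atoms F" and x: "x \<in> carrier F"
    and ba: "b \<sqsubseteq>\<^bsub>F'\<^esub> f a" and bx: "b \<sqsubseteq>\<^bsub>F'\<^esub> f x"
  shows "a \<sqsubseteq>\<^bsub>F\<^esub> x"
proof -
  have "b \<sqsubseteq>\<^bsub>F'\<^esub> f (a \<sqinter>\<^bsub>F\<^esub> x)"
    using assms by (simp add: meet target.meet_le closed atoms_carrier)
  then have "a \<sqinter>\<^bsub>F\<^esub> x \<noteq> \<bottom>\<^bsub>F\<^esub>"
    using target.atom_not_le_bottom[OF b] by (auto simp: bottom)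
  then show ?thesis using source.atom_meet_cases[OF a x] by blast
qed

text \<open>The element \<open>f x\<close> need not be a join of atoms, nor \<open>x\<close>, yet covering makes the atoms below
  \<open>f x\<close> computable from the atoms below \<open>x\<close>: this is naturality of \<open>psi\<close>.\<close>

lemma psi_image:
  assumes cov: "atom_covering F F' f" and x: "x \<in> carrier F"
  shows "psi F' (f x) = xi F' f (psi F x)"
proof (intro equalityI subsetI)
  fix b assume "b \<in> psi F' (f x)"
  then have b: "b \<in> atoms F'" "b \<sqsubseteq>\<^bsub>F'\<^esub> f x" by (auto simp: psi_def)
  with cov obtain a where a: "a \<in> atoms F" "b \<sqsubseteq>\<^bsub>F'\<^esub> f a" by (auto simp: atom_covering_def)
  with atom_le_image[of b a x] b x show "b \<in> xi F' f (psi F x)" by (auto simp: xi_def psi_def)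
next
  fix b assume "b \<in> xi F' f (psi F x)"
  then obtain a where a: "a \<in> atoms F" "a \<sqsubseteq>\<^bsub>F\<^esub> x" and b: "b \<in> atoms F'" "b \<sqsubseteq>\<^bsub>F'\<^esub> f a"
    by (auto simp: xi_def psi_def)
  have "b \<sqsubseteq>\<^bsub>F'\<^esub> f x"
    using target.le_trans[OF b(2) mono[of a x]] a b x by (simp add: atoms_carrier closed)
  with b show "b \<in> psi F' (f x)" by (simp add: psi_def)
qed

text \<open>If \<open>b\<close> lies in every \<open>xi F' f X\<close>, then each \<open>X\<close> contains an atom whose image is above \<open>b\<close>, and
  these atoms all coincide. For empty \<open>Q\<close> there is such an atom because \<open>f\<close> is covering.\<close>

lemma xi_Inter:
  assumes cov: "atom_covering F F' f" and Q: "Q \<subseteq> Pow (atoms F)"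
  shows "xi F' f (atoms F \<inter> \<Inter>Q) = atoms F' \<inter> (\<Inter>X\<in>Q. xi F' f X)"
proof (intro equalityI subsetI)
  fix b assume b: "b \<in> atoms F' \<inter> (\<Inter>X\<in>Q. xi F' f X)"
  with cov obtain a where a: "a \<in> atoms F" "b \<sqsubseteq>\<^bsub>F'\<^esub> f a" by (auto simp: atom_covering_def)
  have "a \<in> X" if X: "X \<in> Q" for X
  proof -
    have "b \<in> xi F' f X" using b X by blast
    then obtain c where "c \<in> X" "b \<sqsubseteq>\<^bsub>F'\<^esub> f c" by (auto simp: xi_def psi_def)
    moreover have "c \<in> atoms F" using \<open>c \<in> X\<close> X Q by auto
    ultimately show ?thesis
      using atom_le_image[of b a c] source.atom_le_atom[of a c] a b by (auto simp: atoms_carrier)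
  qed
  with a b show "b \<in> xi F' f (atoms F \<inter> \<Inter>Q)" by (auto simp: xi_def psi_def)
qed (auto simp: xi_def psi_def)

lemma xi_complete_iff: "xi_complete F F' f \<longleftrightarrow> atom_covering F F' f"
proof -
  let ?P = "powerset_order (atoms F)" and ?P' = "powerset_order (atoms F')"
  interpret P: powerset_copy "atoms F" ?P "\<lambda>X. X" by (rule powerset_copy_powerset_order)
  interpret P': powerset_copy "atoms F'" ?P' "\<lambda>X. X" by (rule powerset_copy_powerset_order)
  have carrier: "carrier ?P = Pow (atoms F)" by (simp add: powerset_order_def)
  have img: "xi F' f ` Q \<subseteq> Pow (atoms F')" for Q by (auto simp: xi_def psi_def)
  have inf: "inf_pres ?P ?P' (xi F' f) \<longleftrightarrow>
      (\<forall>Q\<subseteq>Pow (atoms F). xi F' f (atoms F \<inter> \<Inter>Q) = atoms F' \<inter> (\<Inter>X\<in>Q. xi F' f X))"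
    using P.Inf_image P'.Inf_image[OF img]
    by (simp add: inf_pres_def P.complete_lattice_axioms P'.complete_lattice_axioms carrier)
  have sup: "sup_pres ?P ?P' (xi F' f)"
    using P.Sup_image P'.Sup_image[OF img]
    by (simp add: sup_pres_def P.complete_lattice_axioms P'.complete_lattice_axioms carrier xi_def)
  show ?thesis
  proof
    assume "xi_complete F F' f"
    \<comment> \<open>Preservation of the empty infimum alone forces covering.\<close>
    then have "xi F' f (atoms F \<inter> \<Inter>{}) = atoms F' \<inter> (\<Inter>X\<in>{}. xi F' f X)"
      unfolding xi_complete_def inf by blast
    then have "xi F' f (atoms F) = atoms F'" by simp
    then show "atom_covering F F' f" by (auto simp: atom_covering_def xi_def psi_def)
  next
    assume "atom_covering F F' f"
    then show "xi_complete F F' f" using sup by (simp add: xi_complete_def inf xi_Inter)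
  qed
qed

text \<open>The top of \<open>F\<close> is the join of all atoms, so the images of the atoms have join \<open>\<top>\<close>, and atoms of
  \<open>F'\<close> are join prime.\<close>

lemma covering_if_atomic_source:
  assumes "atomic_frame F"
  shows "atom_covering F F' f"
  unfolding atom_covering_def
proof
  fix b assume b: "b \<in> atoms F'"
  have "\<Squnion>\<^bsub>F\<^esub>(atoms F) = \<top>\<^bsub>F\<^esub>"
    using Sup_psi[OF assms, of "\<top>\<^bsub>F\<^esub>"] by (simp add: source.psi_top)
  then have "\<Squnion>\<^bsub>F'\<^esub>(f ` atoms F) = \<top>\<^bsub>F'\<^esub>"
    using Sup[OF atoms_subset_carrier] by (simp add: top)
  then have "b \<sqsubseteq>\<^bsub>F'\<^esub> \<Squnion>\<^bsub>F'\<^esub>(f ` atoms F)"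
    using target.top_higher[OF atoms_carrier[OF b]] by argo
  moreover have "f ` atoms F \<subseteq> carrier F'"
    using closed by (auto dest: atoms_carrier)
  ultimately show "\<exists>a\<in>atoms F. b \<sqsubseteq>\<^bsub>F'\<^esub> f a"
    using target.atom_le_Sup_iff[OF b] by simp
qed

text \<open>Under \<open>psi F'\<close> both sides become an intersection of sets \<open>xi F' f (psi F x)\<close>, by naturality of
  \<open>psi\<close> and since \<open>xi F' f\<close> preserves intersections.\<close>

lemma inf_pres_if_atomic_target:
  assumes F': "atomic_frame F'" and cov: "atom_covering F F' f"
  shows "inf_pres F F' f"
  unfolding inf_pres_def
proof (intro conjI allI impI source.complete_lattice_axioms target.complete_lattice_axioms)
  fix A assume A: "A \<subseteq> carrier F"
  then have fA: "f ` A \<subseteq> carrier F'" by (auto simp: closed)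
  show "f (\<Sqinter>\<^bsub>F\<^esub>A) = \<Sqinter>\<^bsub>F'\<^esub>(f ` A)"
  proof (rule psi_inject[OF F'])
    have "psi F' (f (\<Sqinter>\<^bsub>F\<^esub>A)) = xi F' f (atoms F \<inter> \<Inter>(psi F ` A))"
      using A by (simp add: psi_image[OF cov] source.psi_Inf)
    also have "\<dots> = atoms F' \<inter> (\<Inter>x\<in>A. xi F' f (psi F x))"
      using xi_Inter[OF cov, of "psi F ` A"] psi_subset_atoms[of F] by (simp add: image_subset_iff)
    also have "\<dots> = psi F' (\<Sqinter>\<^bsub>F'\<^esub>(f ` A))"
    proof -
      have "psi F' (f x) = xi F' f (psi F x)" if "x \<in> A" for x
        using that A by (intro psi_image[OF cov]) auto
      then show ?thesis by (simp add: target.psi_Inf[OF fA])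
    qed
    finally show "psi F' (f (\<Sqinter>\<^bsub>F\<^esub>A)) = psi F' (\<Sqinter>\<^bsub>F'\<^esub>(f ` A))" .
  qed (use A fA in \<open>auto intro: closed\<close>)
qed

end

lemma Hom_Frm_at_iff:
  assumes "frame F" "frame F'"
  shows "f \<in> Hom Frm_at F F' \<longleftrightarrow> f \<in> frame_hom F F' \<and> atom_covering F F' f"
  using assms frame_morphism.xi_complete_iff[of F F' f]
  by (auto simp: Frm_at_def frame_morphism_def frame_morphism_axioms_def)

text \<open>Fullness of the inclusion: atomicity of \<open>F\<close> gives covering, and with it atomicity of \<open>F'\<close> gives
  preservation of infima.\<close>

lemma Hom_AtFrm_eq:
  assumes F: "atomic_frame F" and F': "atomic_frame F'"
  shows "Hom AtFrm F F' = Hom Frm_at F F'"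
proof -
  have fr: "frame F" "frame F'" using F F' by (auto simp: atomic_frame_def)
  have "atom_covering F F' f \<and> inf_pres F F' f" if f: "f \<in> frame_hom F F'" for f
  proof -
    interpret frame_morphism F F' f
      using f fr by (simp add: frame_morphism_def frame_morphism_axioms_def)
    show ?thesis
      using covering_if_atomic_source[OF F] inf_pres_if_atomic_target[OF F'] by blast
  qed
  then show ?thesis
    by (auto simp: Hom_Frm_at_iff[OF fr] AtFrm_def complete_frame_hom_def)
qed

lemma frame_morphism_if_Hom_Frm_at:
  "\<lbrakk>frame F; frame F'; f \<in> Hom Frm_at F F'\<rbrakk> \<Longrightarrow> frame_morphism F F' f"
  by (simp add: Hom_Frm_at_iff frame_morphism_def frame_morphism_axioms_def)

lemma Frm_at_simps [simp]:
  "Ob Frm_at = {F. frame F}"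
  "idn Frm_at F = restrict id (carrier F)"
  "cmp Frm_at F F' F'' g f = compose (carrier F) g f"
  by (simp_all add: Frm_at_def)

lemma AtFrm_simps [simp]:
  "Ob AtFrm = {F. atomic_frame F}"
  "idn AtFrm F = restrict id (carrier F)"
  "cmp AtFrm F F' F'' g f = compose (carrier F) g f"
  by (simp_all add: AtFrm_def)

lemma Hom_Frm_at_extensional: "f \<in> Hom Frm_at F F' \<Longrightarrow> f \<in> carrier F \<rightarrow>\<^sub>E carrier F'"
  by (simp add: Frm_at_def frame_hom_def)

lemma idn_in_Frm_at:
  assumes "frame F"
  shows "restrict id (carrier F) \<in> Hom Frm_at F F"
proof -
  interpret frame F by (rule assms)
  have "(\<lambda>x. if x \<in> carrier F then x else undefined) ` A = A" if "A \<subseteq> carrier F" for A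
    using that by (auto simp: image_iff subset_iff)
  then have "restrict id (carrier F) \<in> frame_hom F F"
    by (auto simp: frame_hom_def sup_pres_def meet_pres_def complete_lattice_axioms
        lattice_axioms restrict_def)
  moreover have "atom_covering F F (restrict id (carrier F))"
    unfolding atom_covering_def
    by (metis atoms_carrier id_apply le_refl restrict_apply')
  ultimately show ?thesis by (simp add: Hom_Frm_at_iff assms)
qed

lemma cmp_in_Frm_at:
  assumes fr: "frame F" "frame F'" "frame F''"
    and f: "f \<in> Hom Frm_at F F'" and g: "g \<in> Hom Frm_at F' F''"
  shows "compose (carrier F) g f \<in> Hom Frm_at F F''"
proof -
  interpret f: frame_morphism F F' f using fr f by (intro frame_morphism_if_Hom_Frm_at)
  interpret g: frame_morphism F' F'' g using fr g by (intro frame_morphism_if_Hom_Frm_at)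
  have img: "compose (carrier F) g f ` A = g ` f ` A" if "A \<subseteq> carrier F" for A
    using that by (auto simp: compose_def image_iff subset_iff)
  have fA: "f ` A \<subseteq> carrier F'" if "A \<subseteq> carrier F" for A
    using that f.closed by auto
  have "compose (carrier F) g f \<in> frame_hom F F''"
    unfolding frame_hom_def sup_pres_def meet_pres_def
    by (auto simp: PiE_iff compose_eq compose_extensional img fA f.closed g.closed f.Sup g.Sup f.meet g.meet f.top g.top
        f.source.complete_lattice_axioms g.target.complete_lattice_axioms
        f.source.lattice_axioms g.target.lattice_axioms)
  moreover have "atom_covering F F'' (compose (carrier F) g f)"
    unfolding atom_covering_def
  proof
    fix c assume c: "c \<in> atoms F''"
    then obtain b where b: "b \<in> atoms F'" "c \<sqsubseteq>\<^bsub>F''\<^esub> g b"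
      using g fr by (auto simp: Hom_Frm_at_iff atom_covering_def)
    then obtain a where a: "a \<in> atoms F" "b \<sqsubseteq>\<^bsub>F'\<^esub> f a"
      using f fr by (auto simp: Hom_Frm_at_iff atom_covering_def)
    have "c \<sqsubseteq>\<^bsub>F''\<^esub> g (f a)"
      using g.target.le_trans[OF b(2) g.mono[OF _ _ a(2)]] a b c
      by (simp add: atoms_carrier f.closed g.closed)
    with a show "\<exists>a\<in>atoms F. c \<sqsubseteq>\<^bsub>F''\<^esub> compose (carrier F) g f a"
      by (auto simp: compose_eq atoms_carrier)
  qed
  ultimately show ?thesis by (simp add: Hom_Frm_at_iff fr)
qed

lemma category_Frm_at: "category Frm_at"
proof
  fix X Y f assume "f \<in> Hom Frm_at X Y"
  then have f: "f \<in> carrier X \<rightarrow>\<^sub>E carrier Y" by (rule Hom_Frm_at_extensional)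
  show "cmp Frm_at X X Y f (idn Frm_at X) = f" "cmp Frm_at X Y Y (idn Frm_at Y) f = f"
    using f by (auto simp: compose_def fun_eq_iff PiE_iff extensional_def)
next
  fix W X Y Z f g h assume "f \<in> Hom Frm_at W X"
  then have "f \<in> carrier W \<rightarrow> carrier X" using Hom_Frm_at_extensional by blast
  then show "cmp Frm_at W Y Z h (cmp Frm_at W X Y g f) = cmp Frm_at W X Z (cmp Frm_at X Y Z h g) f"
    by (simp add: compose_assoc)
qed (simp_all add: idn_in_Frm_at cmp_in_Frm_at)

lemma category_AtFrm: "category AtFrm"
proof -
  interpret category Frm_at by (rule category_Frm_at)
  show ?thesis
  proof
    fix X Y Z f g
    assume "X \<in> Ob AtFrm" "Y \<in> Ob AtFrm" "Z \<in> Ob AtFrm" "f \<in> Hom AtFrm X Y" "g \<in> Hom AtFrm Y Z"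
    then show "cmp AtFrm X Y Z g f \<in> Hom AtFrm X Z"
      using cmp_in[of X Y Z f g] by (simp add: Hom_AtFrm_eq atomic_frame_frame)
  next
    fix W X Y Z f g h
    assume "W \<in> Ob AtFrm" "X \<in> Ob AtFrm" "Y \<in> Ob AtFrm" "Z \<in> Ob AtFrm"
      "f \<in> Hom AtFrm W X" "g \<in> Hom AtFrm X Y" "h \<in> Hom AtFrm Y Z"
    then show "cmp AtFrm W Y Z h (cmp AtFrm W X Y g f) = cmp AtFrm W X Z (cmp AtFrm X Y Z h g) f"
      using cmp_assoc[of W X Y Z f g h] by (simp add: Hom_AtFrm_eq atomic_frame_frame)
  next
    fix X Y f
    assume "X \<in> Ob AtFrm" "Y \<in> Ob AtFrm" "f \<in> Hom AtFrm X Y"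
    then show "cmp AtFrm X X Y f (idn AtFrm X) = f" "cmp AtFrm X Y Y (idn AtFrm Y) f = f"
      using cmp_idn[of X Y f] idn_cmp[of X Y f] by (simp_all add: Hom_AtFrm_eq atomic_frame_frame)
  qed (simp add: Hom_AtFrm_eq atomic_frame_frame idn_in_Frm_at)
qed

lemma full_embedding_incl: "full_embedding AtFrm Frm_at incl"
proof -
  interpret source: category AtFrm by (rule category_AtFrm)
  interpret target: category Frm_at by (rule category_Frm_at)
  have "functor_between AtFrm Frm_at incl"
    by unfold_locales (auto simp: incl_def Hom_AtFrm_eq atomic_frame_frame)
  then show ?thesis
    by (auto simp: full_embedding_def fully_faithful_def incl_def Hom_AtFrm_eq bij_betw_def)
qed


section \<open>The unit of the reflection\<close>

text \<open>The powerset of the atoms enters through an arbitrary copy \<open>P\<close>, which the theorem takes to be the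
  transport along the given encoding.\<close>

locale atom_powerset = source: frame F + copy: powerset_copy "atoms F" P e
  for F :: "'a gorder" and P :: "'b gorder" and e :: "'a set \<Rightarrow> 'b"
begin

definition unit :: "'a \<Rightarrow> 'b" where
  "unit = (\<lambda>x\<in>carrier F. e (psi F x))"

lemma unit_apply: "x \<in> carrier F \<Longrightarrow> unit x = e (psi F x)"
  by (simp add: unit_def)

lemma unit_atom: "a \<in> atoms F \<Longrightarrow> unit a = e {a}"
  by (simp add: unit_apply atoms_carrier source.psi_atom)

lemma unit_frame_hom: "unit \<in> frame_hom F P"
proof -
  have "unit (\<Squnion>\<^bsub>F\<^esub>A) = \<Squnion>\<^bsub>P\<^esub>(unit ` A)" if A: "A \<subseteq> carrier F" for A
  proof -
    have "unit ` A = e ` psi F ` A" using A by (auto simp: unit_apply image_image subset_iff)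
    then show ?thesis
      using A copy.Sup_image[of "psi F ` A"] psi_subset_atoms[of F]
      by (simp add: unit_apply source.psi_Sup image_subset_iff)
  qed
  then show ?thesis
    by (auto simp: frame_hom_def sup_pres_def meet_pres_def unit_apply source.psi_meet
        source.psi_top copy.meet_image copy.top_image psi_subset_atoms copy.e_closed
        source.complete_lattice_axioms copy.complete_lattice_axioms
        source.lattice_axioms copy.lattice_axioms) (simp add: unit_def)
qed

lemma unit_covering: "atom_covering F P unit"
  by (auto simp: atom_covering_def copy.atoms_image unit_atom copy.e_closed intro!: bexI)

text \<open>Every element of \<open>P\<close> is a join of singletons \<open>e {a}\<close>, the values of the unit at the atoms.\<close>

lemma determined_by_unit:
  assumes "frame A" "g \<in> frame_hom P A" "g' \<in> frame_hom P A"
    and eq: "\<And>x. x \<in> carrier F \<Longrightarrow> g (unit x) = g' (unit x)"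
  shows "g = g'"
proof
  interpret g: frame_morphism P A g
    using assms by (simp add: frame_morphism_def frame_morphism_axioms_def copy.frame_axioms)
  interpret g': frame_morphism P A g'
    using assms by (simp add: frame_morphism_def frame_morphism_axioms_def copy.frame_axioms)
  fix z show "g z = g' z"
  proof (cases "z \<in> carrier P")
    case True
    then obtain X where X: "X \<subseteq> atoms F" "z = e X" by (rule copy.carrierE)
    have z: "z = \<Squnion>\<^bsub>P\<^esub>(unit ` X)"
    proof -
      have "unit ` X = e ` (\<lambda>a. {a}) ` X" using X by (auto simp: unit_atom image_image subset_iff)
      moreover have "(\<lambda>a. {a}) ` X \<subseteq> Pow (atoms F)" using X by auto
      ultimately show ?thesis using X copy.Sup_image[of "(\<lambda>a. {a}) ` X"] by simp
    qed
    have "unit ` X \<subseteq> carrier P" using X by (auto simp: unit_atom copy.e_closed subset_iff)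
    moreover have "g ` unit ` X = g' ` unit ` X"
      using X eq by (auto simp: image_image atoms_carrier subset_iff intro!: image_cong)
    ultimately show ?thesis by (simp add: z g.Sup g'.Sup)
  next
    case False
    moreover have "g \<in> carrier P \<rightarrow>\<^sub>E carrier A" "g' \<in> carrier P \<rightarrow>\<^sub>E carrier A"
      using assms(2,3) by (simp_all add: frame_hom_def)
    ultimately show ?thesis using PiE_arb by metis
  qed
qed

definition extension :: "'c gorder \<Rightarrow> ('a \<Rightarrow> 'c) \<Rightarrow> 'b \<Rightarrow> 'c" where
  "extension A f = (\<lambda>z\<in>carrier P. \<Squnion>\<^bsub>A\<^esub>(f ` inv_into (Pow (atoms F)) e z))"

lemma extension_apply: "X \<subseteq> atoms F \<Longrightarrow> extension A f (e X) = \<Squnion>\<^bsub>A\<^esub>(f ` X)"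
  using copy.bij by (simp add: extension_def copy.e_closed bij_betw_def)

text \<open>
  Under \<open>psi A\<close> the value at \<open>e X\<close> is \<open>xi A f X\<close>, so joins, binary meets and top are preserved because
  \<open>xi A f\<close> preserves unions, intersections and the set of all atoms. The restriction along the unit is
  \<open>f\<close> by naturality of \<open>psi\<close>.
\<close>

lemma extension:
  assumes A: "atomic_frame A" and f: "f \<in> frame_hom F A" and cov: "atom_covering F A f"
  shows extension_frame_hom: "extension A f \<in> frame_hom P A"
    and extension_unit: "x \<in> carrier F \<Longrightarrow> extension A f (unit x) = f x"
proof -
  interpret f: frame_morphism F A f
    using A f by (simp add: frame_morphism_def frame_morphism_axioms_def atomic_frame_def
        source.frame_axioms)
  let ?g = "extension A f"
  have fX: "f ` X \<subseteq> carrier A" if "X \<subseteq> atoms F" for X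
    using that by (auto simp: f.closed atoms_carrier)
  have closed: "?g (e X) \<in> carrier A" if "X \<subseteq> atoms F" for X
    using that fX by (simp add: extension_apply)
  have psi_g: "psi A (?g (e X)) = xi A f X" if "X \<subseteq> atoms F" for X
    using that fX by (simp add: extension_apply f.target.psi_Sup xi_def)
  have Sup: "?g (\<Squnion>\<^bsub>P\<^esub>Z) = \<Squnion>\<^bsub>A\<^esub>(?g ` Z)" if Z: "Z \<subseteq> carrier P" for Z
  proof -
    obtain Q where Q: "Q \<subseteq> Pow (atoms F)" "Z = e ` Q" using Z by (rule copy.subset_carrierE)
    have UQ: "\<Union>Q \<subseteq> atoms F" using Q by auto
    have gZ: "?g ` Z \<subseteq> carrier A" using Q closed by auto
    have "psi A (?g (e (\<Union>Q))) = (\<Union>X\<in>Q. xi A f X)"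
      using psi_g[OF UQ] by (auto simp: xi_def)
    also have "\<dots> = (\<Union>X\<in>Q. psi A (?g (e X)))"
      using Q psi_g by (intro SUP_cong) auto
    also have "\<dots> = psi A (\<Squnion>\<^bsub>A\<^esub>(?g ` Z))"
      unfolding f.target.psi_Sup[OF gZ] using Q by simp
    finally have "psi A (?g (e (\<Union>Q))) = psi A (\<Squnion>\<^bsub>A\<^esub>(?g ` Z))" .
    then have "?g (e (\<Union>Q)) = \<Squnion>\<^bsub>A\<^esub>(?g ` Z)"
      by (rule psi_inject[OF A closed[OF UQ] f.target.sup_closed[OF gZ]])
    then show ?thesis using Q by (simp add: copy.Sup_image)
  qed
  have meet: "?g (e X \<sqinter>\<^bsub>P\<^esub> e Y) = ?g (e X) \<sqinter>\<^bsub>A\<^esub> ?g (e Y)"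
    if X: "X \<subseteq> atoms F" and Y: "Y \<subseteq> atoms F" for X Y
  proof -
    have XY: "X \<inter> Y \<subseteq> atoms F" using X by auto
    have "xi A f (X \<inter> Y) = xi A f X \<inter> xi A f Y"
      using f.xi_Inter[OF cov, of "{X, Y}"] X Y by (auto simp: Int_absorb1 xi_def psi_def)
    then have eq: "psi A (?g (e (X \<inter> Y))) = psi A (?g (e X) \<sqinter>\<^bsub>A\<^esub> ?g (e Y))"
      using X Y XY by (simp add: psi_g f.target.psi_meet closed)
    have "?g (e (X \<inter> Y)) = ?g (e X) \<sqinter>\<^bsub>A\<^esub> ?g (e Y)"
      by (rule psi_inject[OF A _ _ eq]) (simp_all add: X Y XY closed)
    then show ?thesis using X Y by (simp add: copy.meet_image)
  qed
  have "xi A f (atoms F) = atoms A"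
    using cov by (auto simp: atom_covering_def xi_def psi_def)
  then have top: "?g \<top>\<^bsub>P\<^esub> = \<top>\<^bsub>A\<^esub>"
    unfolding copy.top_image
    by (intro psi_inject[OF A]) (auto simp: psi_g f.target.psi_top closed)
  show "?g \<in> frame_hom P A"
    unfolding frame_hom_def sup_pres_def meet_pres_def
    using Sup meet top closed
    by (auto simp: copy.complete_lattice_axioms f.target.complete_lattice_axioms
        copy.lattice_axioms f.target.lattice_axioms elim!: copy.carrierE)
      (simp add: extension_def)
  show "?g (unit x) = f x" if "x \<in> carrier F"
    by (rule psi_inject[OF A])
      (use that closed f.closed in \<open>auto simp: unit_apply psi_g psi_subset_atoms f.psi_image[OF cov]\<close>)
qed

lemma extension_complete_frame_hom:
  assumes A: "atomic_frame A" and f: "f \<in> frame_hom F A" and cov: "atom_covering F A f"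
  shows "extension A f \<in> complete_frame_hom P A"
proof -
  interpret frame_morphism P A "extension A f"
    using extension_frame_hom[OF assms] A
    by (simp add: frame_morphism_def frame_morphism_axioms_def atomic_frame_frame copy.frame_axioms)
  show ?thesis
    using hom inf_pres_if_atomic_target[OF A covering_if_atomic_source[OF copy.atomic]]
    by (simp add: complete_frame_hom_def)
qed

end

text \<open>This bijection is the universal property of the reflection; its inverse is \<open>extension A\<close>.\<close>

lemma bij_betw_compose_unit:
  fixes F P A :: "'u gorder"
  assumes "atom_powerset F P e" and A: "atomic_frame A"
  shows "bij_betw (\<lambda>g. compose (carrier F) g (atom_powerset.unit F e))
    (Hom AtFrm P A) (Hom Frm_at F A)"
proof -
  interpret atom_powerset F P e by fact
  note fr = source.frame_axioms copy.frame_axioms atomic_frame_frame[OF A]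
  have Hom: "Hom AtFrm P A = Hom Frm_at P A" by (rule Hom_AtFrm_eq[OF copy.atomic A])
  have unit: "unit \<in> Hom Frm_at F P" by (simp add: Hom_Frm_at_iff fr unit_frame_hom unit_covering)
  show ?thesis
    unfolding bij_betw_def
  proof (intro conjI inj_onI equalityI subsetI)
    fix g g' assume *: "g \<in> Hom AtFrm P A" "g' \<in> Hom AtFrm P A"
      "compose (carrier F) g unit = compose (carrier F) g' unit"
    have "g (unit x) = g' (unit x)" if "x \<in> carrier F" for x
      using fun_cong[OF *(3), of x] that by (simp add: compose_eq)
    then show "g = g'"
      using * determined_by_unit fr by (auto simp: Hom Hom_Frm_at_iff)
  next
    fix h assume "h \<in> (\<lambda>g. compose (carrier F) g unit) ` Hom AtFrm P A"
    then show "h \<in> Hom Frm_at F A" using cmp_in_Frm_at[OF fr unit] by (auto simp: Hom)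
  next
    fix f assume f: "f \<in> Hom Frm_at F A"
    then have f': "f \<in> frame_hom F A" "atom_covering F A f" by (simp_all add: Hom_Frm_at_iff fr)
    show "f \<in> (\<lambda>g. compose (carrier F) g unit) ` Hom AtFrm P A"
    proof (rule image_eqI)
      show "extension A f \<in> Hom AtFrm P A"
        using extension_complete_frame_hom[OF A f'] by (simp add: AtFrm_def)
      show "f = compose (carrier F) (extension A f) unit"
      proof
        fix x show "f x = compose (carrier F) (extension A f) unit x"
        proof (cases "x \<in> carrier F")
          case True
          then show ?thesis by (simp add: compose_eq extension_unit[OF A f'])
        next
          case False
          then show ?thesis
            using PiE_arb[OF Hom_Frm_at_extensional[OF f] False] by (simp add: compose_def)
        qed
      qed
    qed
  qed
qed

text \<open>The extension sends \<open>X\<close> to the join of the sets \<open>psi F' (f a)\<close> with \<open>a \<in> X\<close>, and joins in the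
  powerset are unions: this is the definition of \<open>xi\<close>.\<close>

lemma transport_xi_eq_extension:
  assumes F: "atom_powerset F P e" and F': "atom_powerset F' P' e'" and f: "f \<in> frame_hom F F'"
  shows "transport_map e (powerset_order (atoms F)) e' (xi F' f)
    = atom_powerset.extension F P e P' (compose (carrier F) (atom_powerset.unit F' e') f)"
proof
  interpret F: atom_powerset F P e by (rule F)
  interpret F': atom_powerset F' P' e' by (rule F')
  interpret frame_morphism F F' f
    by (simp add: frame_morphism_def frame_morphism_axioms_def f F.source.frame_axioms
        F'.source.frame_axioms)
  let ?h = "compose (carrier F) F'.unit f" and ?T = "transport_map e (powerset_order (atoms F)) e' (xi F' f)"
  have img: "e ` carrier (powerset_order (atoms F)) = carrier P"
    using F.copy.bij by (simp add: powerset_order_def bij_betw_def)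
  fix z show "?T z = F.extension P' ?h z"
  proof (cases "z \<in> carrier P")
    case True
    then obtain X where X: "X \<subseteq> atoms F" "z = e X" by (rule F.copy.carrierE)
    have "inv_into (Pow (atoms F)) e (e X) = X"
      using F.copy.bij X by (simp add: bij_betw_def)
    then have "?T z = e' (xi F' f X)"
      using True X img by (simp add: transport_map_def powerset_order_def)
    also have "\<dots> = \<Squnion>\<^bsub>P'\<^esub>(e' ` (\<lambda>a. psi F' (f a)) ` X)"
      using psi_subset_atoms[of F'] by (subst F'.copy.Sup_image) (auto simp: xi_def)
    also have "e' ` (\<lambda>a. psi F' (f a)) ` X = ?h ` X"
      unfolding image_image
      by (rule image_cong) (use X in \<open>auto simp: compose_eq F'.unit_apply closed atoms_carrier subset_iff\<close>)
    finally show ?thesis using X by (simp add: F.extension_apply)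
  next
    case False
    then show ?thesis by (simp add: transport_map_def F.extension_def img)
  qed
qed

theorem theorem6p10:
  fixes enc :: "'u gorder \<Rightarrow> 'u set \<Rightarrow> 'u"
  assumes "set_encoding enc"
  shows "full_reflective AtFrm Frm_at incl (reflector enc)"
proof -
  let ?L = "\<lambda>F. transport_order (enc F) (powerset_order (atoms F))"
  let ?\<eta> = "\<lambda>F. atom_powerset.unit F (enc F)"
  have L: "atom_powerset F (?L F) (enc F)" if "frame F" for F
    using assms that
    by (simp add: set_encoding_def atom_powerset_def powerset_copy_transport_order)
  have L_atomic: "atomic_frame (?L F)" if "frame F" for F
    using L[OF that] powerset_copy.atomic unfolding atom_powerset_def by blast
  have \<eta>: "?\<eta> F \<in> Hom Frm_at F (?L F)" if "frame F" for F
    using that atom_powerset.unit_frame_hom[OF L[OF that]] atom_powerset.unit_covering[OF L[OF that]]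
    by (simp add: Hom_Frm_at_iff atomic_frame_frame L_atomic)
  have on_ob: "on_ob (reflector enc) F = ?L F" for F
    by (simp add: reflector_def)
  have arr: "on_arr (reflector enc) F F' f \<in> Hom AtFrm (?L F) (?L F')"
    and natural: "compose (carrier F) (on_arr (reflector enc) F F' f) (?\<eta> F)
      = compose (carrier F) (?\<eta> F') f"
    if fr: "frame F" "frame F'" and f: "f \<in> Hom Frm_at F F'" for F F' f
  proof -
    let ?h = "compose (carrier F) (?\<eta> F') f"
    have "?h \<in> Hom Frm_at F (?L F')"
      using cmp_in_Frm_at[OF fr _ f \<eta>] fr by (simp add: L_atomic atomic_frame_frame)
    then have h: "?h \<in> frame_hom F (?L F')" "atom_covering F (?L F') ?h"
      by (simp_all add: Hom_Frm_at_iff fr L_atomic atomic_frame_frame)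
    have eq: "on_arr (reflector enc) F F' f
        = atom_powerset.extension F (?L F) (enc F) (?L F') ?h"
      using transport_xi_eq_extension[OF L L, of F F' f] fr f
      by (simp add: reflector_def Hom_Frm_at_iff)
    show "on_arr (reflector enc) F F' f \<in> Hom AtFrm (?L F) (?L F')"
      unfolding eq AtFrm_def using fr by (simp add: atom_powerset.extension_complete_frame_hom L h L_atomic)
    show "compose (carrier F) (on_arr (reflector enc) F F' f) (?\<eta> F) = ?h"
      using atom_powerset.extension_unit[OF L[OF fr(1)] L_atomic[OF fr(2)] h]
      by (auto simp: eq fun_eq_iff compose_def)
  qed
  have "left_adjoint Frm_at AtFrm (reflector enc) incl"
  proof (rule left_adjoint_if_universal_arrows[where \<eta> = ?\<eta>])
    show "functor_between AtFrm Frm_at incl"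
      using full_embedding_incl unfolding full_embedding_def by blast
  next
    fix F A :: "'u gorder" assume "F \<in> Ob Frm_at" "A \<in> Ob AtFrm"
    then show "bij_betw
        (\<lambda>g. cmp Frm_at F (on_ob incl (on_ob (reflector enc) F)) (on_ob incl A)
          (on_arr incl (on_ob (reflector enc) F) A g) (?\<eta> F))
        (Hom AtFrm (on_ob (reflector enc) F) A) (Hom Frm_at F (on_ob incl A))"
      using bij_betw_compose_unit[OF L, of F A] by (simp add: incl_def on_ob)
  qed (simp_all add: incl_def on_ob arr natural \<eta> L_atomic)
  then show ?thesis by (simp add: full_reflective_def full_embedding_incl)
qed

end
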